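(* Let $(X,d)$ be a metric space and let $f_n:X\to X$, $n\ge 0$, be a sequence of maps, defining the non-autonomous discrete system $x_{n+1}=f_n(x_n)$, $n\ge0$. Let $N\ge 2$ and let $A=(a_{ij})_{N\times N}$ be an irreducible transition matrix with $\sum_{j=1}^{N}a_{i_0j}\ge 2$ for some $1\le i_0\le N$. Let $V_1,\dots,V_N$ be pairwise disjoint nonempty compact subsets of $X$, assume that $f_n$ is continuous in $\bigcup_{i=1}^N V_i$ for every $n\ge0$, and for each $1\le i\le N$ let $\{V_{i,n}\}_{n=0}^\infty$ be a sequence of nonempty closed subsets of $V_i$. For $\alpha=(a_0,a_1,\dots)\in\Sigma_N^+(A)$ and $m,n\ge0$ put $$V_\alpha^{m,n}:=\bigcap_{k=0}^{m}f_n^{-k}(V_{a_k,n+k}).$$ Suppose that (i) $V_\alpha^{m,n}\ne\emptyset$ for all $m,n\ge0$ and all $\alpha\in\Sigma_N^+(A)$; (ii) there exist $\beta=(b_0,b_1,\dots)\in\Sigma_N^+(A)$, an increasing sequence $\{m_k\}_{k=1}^\infty$ of positive integers, and $1\le s_0\le N$ such that $b_{m_k}=s_0$ for all $k\ge1$, and such that for every increasing sequence $\{n_k\}_{k=1}^\infty$ of nonnegative integers, the diameter $d(V_\beta^{m_k,n_k})$ converges to $0$ as $k\to\infty$. Then the system $x_{n+1}=f_n(x_n)$, $n\ge 0$, is chaotic in the strong sense of Li-Yorke.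
   Context: Notation: for $i\ge0$, $n\ge1$, $f_i^n:=f_{i+n-1}\circ\cdots\circ f_i$, and $f_i^0$ is the identity; $f_i^{-n}(B)=\{x\in X: f_i^n(x)\in B\}$. For a nonempty set $B\subset X$, $d(B):=\sup\{d(x,y):x,y\in B\}$ is its diameter. "Increasing" means strictly increasing. "$f_n$ is continuous in $\bigcup_i V_i$" means that the restriction of $f_n$ to this set is continuous. A matrix $A=(a_{ij})_{N\times N}$ ($N\ge2$) is a transition matrix if $a_{ij}\in\{0,1\}$ for all $i,j$, $\sum_{j}a_{ij}\ge1$ for all $i$, and $\sum_i a_{ij}\ge1$ for all $j$. It is irreducible if for each pair $1\le i,j\le N$ there is a positive integer $k$ such that the $(i,j)$ entry of $A^k$ is positive. $\Sigma_N^+(A):=\{(s_0,s_1,\dots): 1\le s_j\le N,\ a_{s_js_{j+1}}=1,\ j\ge0\}$. The system $x_{n+1}=f_n(x_n)$ is Li-Yorke $\delta$-chaotic ($\delta>0$) if there is an uncountable set $S\subset X$ such that for all distinct $x,y\in S$, $\liminf_{n\to\infty}d(f_0^n(x),f_0^n(y))=0$ and $\limsup_{n\to\infty}d(f_0^n(x),f_0^n(y))>\delta$. It is chaotic in the strong sense of Li-Yorke if, for some $\delta>0$, there is such a set $S$ for which, in addition, every orbit $\{f_0^n(x)\}_{n\ge0}$, $x\in S$, is bounded. *)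

theory Defs
  imports "HOL-Analysis.Analysis"
begin

text \<open>
  The metric space is a type of class \<open>metric_space\<close>. The index set of an
  \<open>N \<times> N\<close> matrix, which is also the alphabet of the shift, is a finite type \<open>'n\<close>
  with \<open>CARD('n)\<close> in the role of \<open>N\<close>; the entry in row \<open>i\<close> and column \<open>j\<close> is
  \<open>A $ i $ j\<close>.
\<close>

primrec nds_iter :: "(nat \<Rightarrow> 'a \<Rightarrow> 'a) \<Rightarrow> nat \<Rightarrow> nat \<Rightarrow> 'a \<Rightarrow> 'a" where
  "nds_iter f i 0 = id"
| "nds_iter f i (Suc n) = f (i + n) \<circ> nds_iter f i n"

definition transition_matrix :: "nat ^ 'n ^ 'n \<Rightarrow> bool" where
  "transition_matrix A \<longleftrightarrow>
     (\<forall>i j. A $ i $ j \<in> {0, 1}) \<and>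
     (\<forall>i. (\<Sum>j\<in>UNIV. A $ i $ j) \<ge> 1) \<and>
     (\<forall>j. (\<Sum>i\<in>UNIV. A $ i $ j) \<ge> 1)"

text \<open>The \<open>k\<close>-th power with respect to the matrix product \<open>**\<close>.\<close>
definition matrix_power :: "nat ^ 'n ^ 'n \<Rightarrow> nat \<Rightarrow> nat ^ 'n ^ 'n" where
  "matrix_power A k = (((**) A) ^^ k) (mat 1)"

definition irreducible_matrix :: "nat ^ 'n ^ 'n \<Rightarrow> bool" where
  "irreducible_matrix A \<longleftrightarrow> (\<forall>i j. \<exists>k>0. matrix_power A k $ i $ j > 0)"

definition subshift :: "nat ^ 'n ^ 'n \<Rightarrow> (nat \<Rightarrow> 'n) set" where
  "subshift A = {s. \<forall>j. A $ s j $ s (Suc j) = 1}"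

text \<open>\<open>itinerary_set f W \<alpha> m n\<close> is the set \<open>V\<^sub>\<alpha>\<close> with upper indices \<open>m\<close>, \<open>n\<close>
  for the family \<open>W i n\<close> of closed sets.\<close>
definition itinerary_set ::
  "(nat \<Rightarrow> 'a \<Rightarrow> 'a) \<Rightarrow> ('n \<Rightarrow> nat \<Rightarrow> 'a set) \<Rightarrow> (nat \<Rightarrow> 'n) \<Rightarrow> nat \<Rightarrow> nat \<Rightarrow> 'a set" where
  "itinerary_set f W \<alpha> m n = (\<Inter>k\<in>{0..m}. nds_iter f n k -` W (\<alpha> k) (n + k))"

text \<open>The upper and lower limits are taken in the extended reals, so that an unbounded
  sequence of distances has upper limit \<open>\<infinity>\<close>.\<close>
definition li_yorke_scrambled ::
  "(nat \<Rightarrow> 'a \<Rightarrow> 'a) \<Rightarrow> real \<Rightarrow> 'a::metric_space set \<Rightarrow> bool" where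
  "li_yorke_scrambled f \<delta> S \<longleftrightarrow>
     (\<forall>x\<in>S. \<forall>y\<in>S. x \<noteq> y \<longrightarrow>
        liminf (\<lambda>n. ereal (dist (nds_iter f 0 n x) (nds_iter f 0 n y))) = 0 \<and>
        limsup (\<lambda>n. ereal (dist (nds_iter f 0 n x) (nds_iter f 0 n y))) > ereal \<delta>)"

definition strong_li_yorke_chaotic :: "(nat \<Rightarrow> 'a \<Rightarrow> 'a::metric_space) \<Rightarrow> bool" where
  "strong_li_yorke_chaotic f \<longleftrightarrow>
     (\<exists>\<delta>>0. \<exists>S. uncountable S \<and> li_yorke_scrambled f \<delta> S \<and>
        (\<forall>x\<in>S. bounded (range (\<lambda>n. nds_iter f 0 n x))))"

end

theory Submission
  imports Defs
begin

text \<open>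
  By compactness every symbol sequence of the subshift is the itinerary of some point. Since the
  sets \<open>V i\<close> have positive mutual distance, points whose itineraries differ infinitely often
  separate infinitely often; points whose itineraries contain the words
  \<open>\<beta> 0 \<dots> \<beta> (m k)\<close> at common positions \<open>n k\<close> approach each other along \<open>n k\<close>. So it suffices to
  find uncountably many sequences containing these words at common positions and differing
  pairwise infinitely often. They are obtained by joining the words by one of two distinct connecting
  words of equal length, chosen according to a subset of \<open>\<nat>\<close> in which every membership is
  encoded infinitely often. A vertex \<open>i\<close> with two successors lies on two loops \<open>P\<close>, \<open>Q\<close> with
  different first steps, and \<open>PQ\<close>, \<open>QP\<close> have equal length.
\<close>

lemma nds_iter_add: "nds_iter f n k (nds_iter f 0 n x) = nds_iter f 0 (n + k) x"
  by (induction k) auto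

lemma in_itinerary_set_iff:
  "x \<in> itinerary_set f W \<alpha> m n \<longleftrightarrow> (\<forall>k\<le>m. nds_iter f n k x \<in> W (\<alpha> k) (n + k))"
  by (auto simp: itinerary_set_def)

subsection \<open>Words of the subshift\<close>

text \<open>A positive sum of products has a positive summand. Expanding the leftmost factor of the
  power therefore yields a first edge out of \<open>i\<close> and a positive entry of a lower power.
  The exponent \<open>Suc k\<close> guarantees at least one edge, so \<open>i = j\<close> gives a
  genuine loop.\<close>

lemma matrix_power_path:
  fixes A :: "nat ^ 'n::finite ^ 'n"
  assumes "transition_matrix A" "matrix_power A (Suc k) $ i $ j > 0"
  shows "\<exists>xs. successively (\<lambda>x y. A $ x $ y = 1) (i # xs @ [j])"
  using assms(2)
proof (induction k arbitrary: i)
  case 0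
  then have "A $ i $ j > 0"
    by (simp add: matrix_power_def matrix_mul_rid del: One_nat_def)
  moreover have "A $ i $ j \<in> {0, 1}"
    using assms(1) by (simp add: transition_matrix_def)
  ultimately show ?case
    by (intro exI[of _ "[]"]) auto
next
  case (Suc k)
  have "matrix_power A (Suc (Suc k)) $ i $ j
      = (\<Sum>l\<in>UNIV. A $ i $ l * matrix_power A (Suc k) $ l $ j)"
    by (simp add: matrix_power_def matrix_matrix_mult_def)
  with Suc.prems obtain l where "A $ i $ l * matrix_power A (Suc k) $ l $ j \<noteq> 0"
    by (metis (no_types, lifting) less_numeral_extra(3) sum.neutral)
  then have l: "A $ i $ l \<noteq> 0" "matrix_power A (Suc k) $ l $ j > 0"
    by auto
  have "A $ i $ l \<in> {0, 1}"
    using assms(1) by (simp add: transition_matrix_def)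
  with l have "A $ i $ l = 1"
    by simp
  moreover obtain xs where "successively (\<lambda>x y. A $ x $ y = 1) (l # xs @ [j])"
    using Suc.IH[OF l(2)] by blast
  ultimately show ?case
    by (intro exI[of _ "l # xs"]) simp
qed

lemma irreducible_path:
  fixes A :: "nat ^ 'n::finite ^ 'n"
  assumes "transition_matrix A" "irreducible_matrix A"
  obtains xs where "successively (\<lambda>x y. A $ x $ y = 1) (i # xs @ [j])"
  using assms matrix_power_path unfolding irreducible_matrix_def by (metis gr0_implies_Suc)

lemma two_successors:
  fixes A :: "nat ^ 'n::finite ^ 'n"
  assumes "transition_matrix A" "(\<Sum>j\<in>UNIV. A $ i $ j) \<ge> 2"
  obtains j j' where "j \<noteq> j'" "A $ i $ j = 1" "A $ i $ j' = 1"
proof -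
  have *: "A $ i $ j \<in> {0, 1}" for j
    using assms(1) by (simp add: transition_matrix_def)
  \<comment> \<open>With entries 0 and 1, the row sum counts the successors of
    \<open>i\<close>.\<close>
  have "(\<Sum>j\<in>UNIV. A $ i $ j) = (\<Sum>j\<in>UNIV. if A $ i $ j = 1 then 1 else 0)"
    using * by (intro sum.cong) auto
  also have "\<dots> = card {j. A $ i $ j = 1}"
    by (simp add: sum.If_cases)
  finally have "card {j. A $ i $ j = 1} \<ge> 2"
    using assms(2) by simp
  then obtain B where "B \<subseteq> {j. A $ i $ j = 1}" "card B = 2"
    by (meson obtain_subset_with_card_n)
  then show thesis
    using that by (auto simp: card_2_iff)
qed

lemma two_connecting_words:
  fixes A :: "nat ^ 'n::finite ^ 'n"
  assumes A: "transition_matrix A" "irreducible_matrix A"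
    and "\<exists>i. (\<Sum>j\<in>UNIV. A $ i $ j) \<ge> 2"
  obtains D :: "bool \<Rightarrow> 'n list"
  where "\<And>c. successively (\<lambda>x y. A $ x $ y = 1) (s # D c @ [t])"
    and "length (D True) = length (D False)" and "D True \<noteq> D False"
proof -
  let ?R = "\<lambda>x y. A $ x $ y = 1"
  obtain i where "(\<Sum>j\<in>UNIV. A $ i $ j) \<ge> 2"
    using assms(3) by blast
  then obtain j j' where j: "j \<noteq> j'" "?R i j" "?R i j'"
    using two_successors[OF A(1)] by metis
  obtain xs where xs: "successively ?R (s # xs @ [i])"
    using irreducible_path[OF A] by metis
  obtain ys where ys: "successively ?R (i # ys @ [t])"
    using irreducible_path[OF A] by metis
  obtain p where p: "successively ?R (j # p @ [i])"
    using irreducible_path[OF A] by metis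
  obtain q where q: "successively ?R (j' # q @ [i])"
    using irreducible_path[OF A] by metis
  have glue: "successively ?R (us @ i # vs)"
    if "successively ?R (us @ [i])" "successively ?R (i # vs)" for us vs
    using that by (auto simp: successively_append_iff successively_Cons)
  \<comment> \<open>Go from \<open>s\<close> to \<open>i\<close>, run through both loops in the
    order chosen by \<open>c\<close>, then go on to \<open>t\<close>. The endpoints \<open>s\<close>
    and \<open>t\<close> are left out because they belong to the neighbouring words.\<close>
  define D where "D c = xs @ i # (if c then j # p @ i # j' # q else j' # q @ i # j # p) @ i # ys"
    for c
  have P: "successively ?R (i # (j # p) @ [i])" and Q: "successively ?R (i # (j' # q) @ [i])"
    using p q j by simp_all
  have PQ: "successively ?R ((i # (j # p)) @ i # (j' # q) @ i # ys @ [t])"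
    using glue[of "i # (j # p)" "(j' # q) @ i # ys @ [t]"] glue[of "i # (j' # q)" "ys @ [t]"] P Q ys
    by simp
  have QP: "successively ?R ((i # (j' # q)) @ i # (j # p) @ i # ys @ [t])"
    using glue[of "i # (j' # q)" "(j # p) @ i # ys @ [t]"] glue[of "i # (j # p)" "ys @ [t]"] P Q ys
    by simp
  show thesis
  proof (rule that)
    show "successively ?R (s # D c @ [t])" for c
      using glue[of "s # xs" "(j # p) @ i # (j' # q) @ i # ys @ [t]"]
        glue[of "s # xs" "(j' # q) @ i # (j # p) @ i # ys @ [t]"] xs PQ QP
      by (simp add: D_def)
    \<comment> \<open>The two words first differ right after \<open>xs @ [i]\<close>, where one has
      \<open>j\<close> and the other \<open>j'\<close>.\<close>
    show "length (D True) = length (D False)" "D True \<noteq> D False"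
      using j(1) by (simp_all add: D_def)
  qed
qed

text \<open>All blocks start with the same letter \<open>b\<close>, so \<open>path\<close> says that
  any block may be followed by any other. The number \<open>n k\<close> is the position where block
  \<open>k\<close> starts.\<close>

lemma infinite_concatenation:
  fixes B :: "nat \<Rightarrow> 'b list"
  assumes ne: "\<And>k. B k \<noteq> []"
    and hd: "\<And>k. hd (B k) = b"
    and path: "\<And>k. successively R (B k @ [b])"
  defines "n \<equiv> \<lambda>k. \<Sum>l<k. length (B l)"
  obtains \<alpha> where "\<And>j. R (\<alpha> j) (\<alpha> (Suc j))"
    and "\<And>k j. j < length (B k) \<Longrightarrow> \<alpha> (n k + j) = B k ! j"
proof -
  define P where "P k = concat (map B [0..<k])" for k
  have P_Suc: "P (Suc k) = P k @ B k" for k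
    by (simp add: P_def)
  have length_P: "length (P k) = n k" for k
    by (induction k) (simp_all add: P_Suc n_def, simp add: P_def)
  have ge: "k \<le> length (P k)" for k
  proof (induction k)
    case (Suc k)
    have "length (B k) > 0"
      using ne by simp
    with Suc show ?case
      by (simp add: P_Suc del: length_greater_0_conv)
  qed simp
  \<comment> \<open>By \<open>ge\<close>, nonempty blocks make \<open>P (Suc i)\<close> long enough
    to have a letter at index \<open>i\<close>.\<close>
  define \<alpha> where "\<alpha> i = P (Suc i) ! i" for i
  have P_mono: "P k ! i = P l ! i" if "k \<le> l" "i < length (P k)" for k l i
    using that
  proof (induction l rule: dec_induct)
    case (step l)
    have "length (P k) \<le> length (P l)"
      unfolding length_P n_def using step.hyps by (intro sum_mono2) auto
    with step show ?case
      by (simp add: P_Suc nth_append)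
  qed simp
  have \<alpha>_P: "\<alpha> i = P k ! i" if "i < length (P k)" for i k
  proof (cases "k \<le> Suc i")
    case True
    then show ?thesis
      using P_mono[OF True that] by (simp add: \<alpha>_def)
  next
    case False
    then show ?thesis
      using P_mono[of "Suc i" k i] ge[of "Suc i"] by (simp add: \<alpha>_def)
  qed
  have succ: "successively R (P k @ [b])" for k
  proof (induction k)
    case (Suc k)
    then show ?case
      using path[of k] hd[of k] ne[of k]
      by (auto simp: P_Suc successively_append_iff)
  qed (simp add: P_def)
  show thesis
  proof (rule that)
    show "R (\<alpha> j) (\<alpha> (Suc j))" for j
    proof -
      have len: "Suc j < length (P (Suc (Suc j)))"
        using ge[of "Suc (Suc j)"] by simp
      have "successively R (P (Suc (Suc j)))"
        using succ[of "Suc (Suc j)"] by (simp add: successively_append_iff)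
      then have "R (P (Suc (Suc j)) ! j) (P (Suc (Suc j)) ! Suc j)"
        using len by (simp add: successively_conv_nth)
      then show ?thesis
        using \<alpha>_P len by (metis Suc_lessD)
    qed
    show "\<alpha> (n k + j) = B k ! j" if "j < length (B k)" for k j
      using \<alpha>_P[of "n k + j" "Suc k"] that by (simp add: P_Suc length_P nth_append)
  qed
qed

lemma uncountable_UNIV_nat_set: "uncountable (UNIV :: nat set set)"
proof
  assume "countable (UNIV :: nat set set)"
  then have "range (from_nat_into (UNIV :: nat set set)) = Pow UNIV"
    by (simp add: range_from_nat_into)
  then show False
    using Cantors_theorem by blast
qed

lemma uncountable_itineraries:
  fixes A :: "nat ^ 'n::finite ^ 'n"
  assumes A: "transition_matrix A" "irreducible_matrix A"
    and "\<exists>i. (\<Sum>j\<in>UNIV. A $ i $ j) \<ge> 2"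
    and \<beta>: "\<beta> \<in> subshift A" "\<And>k. \<beta> (m k) = s"
  obtains \<alpha> :: "nat set \<Rightarrow> nat \<Rightarrow> 'n" and n :: "nat \<Rightarrow> nat"
  where "strict_mono n" and "\<And>\<omega>. \<alpha> \<omega> \<in> subshift A"
    and "\<And>\<omega> k j. j \<le> m k \<Longrightarrow> \<alpha> \<omega> (n k + j) = \<beta> j"
    and "\<And>\<omega> \<omega>'. \<omega> \<noteq> \<omega>' \<Longrightarrow> \<exists>\<^sub>\<infinity>j. \<alpha> \<omega> j \<noteq> \<alpha> \<omega>' j"
proof -
  let ?R = "\<lambda>x y. A $ x $ y = 1"
  obtain D where D: "\<And>c. successively ?R (s # D c @ [\<beta> 0])"
    "length (D True) = length (D False)" "D True \<noteq> D False"
    using two_connecting_words[OF assms(1-3), of s "\<beta> 0"] by blast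
  have len_D: "length (D c) = length (D True)" for c
    using D(2) by (cases c) auto
  obtain p where p: "p < length (D True)" "D True ! p \<noteq> D False ! p"
    using D(2,3) nth_equalityI by blast
  \<comment> \<open>Block \<open>k\<close> encodes membership of the first component of \<open>prod_decode k\<close>, which takes every
    value infinitely often.\<close>
  define B where "B \<omega> k = map \<beta> [0..<Suc (m k)] @ D (fst (prod_decode k) \<in> \<omega>)" for \<omega> k
  \<comment> \<open>The positions do not depend on \<omega>, since both connecting words have the
    same length. This makes the copies of the words of \<beta> occur at common times.\<close>
  define n where "n k = (\<Sum>l<k. Suc (m l) + length (D True))" for k
  have len_B: "length (B \<omega> k) = Suc (m k) + length (D True)" for \<omega> k
    using len_D[of "fst (prod_decode k) \<in> \<omega>"] by (simp add: B_def)
  have ne: "B \<omega> k \<noteq> []" and hd: "hd (B \<omega> k) = \<beta> 0" for \<omega> k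
    by (simp_all add: B_def hd_append hd_map del: upt_Suc)
  have path: "successively ?R (B \<omega> k @ [\<beta> 0])" for \<omega> k
  proof -
    \<comment> \<open>The word of \<beta> ends in \<beta> (m k) = \<open>s\<close>, the same letter
      for every \<open>k\<close>. Hence one pair of connecting words from \<open>s\<close> to
      \<beta> 0 serves all blocks.\<close>
    have "successively ?R (map \<beta> [0..<m k] @ [s])"
    proof -
      have "successively ?R (map \<beta> [0..<Suc (m k)])"
        using \<beta>(1) unfolding successively_conv_nth by (auto simp: subshift_def simp del: upt_Suc)
      then show ?thesis
        using \<beta>(2) by simp
    qed
    with D(1)[of "fst (prod_decode k) \<in> \<omega>"] \<beta>(2) show ?thesis
      by (auto simp: B_def successively_append_iff successively_Cons)
  qed
  have "\<exists>a. (\<forall>j. ?R (a j) (a (Suc j))) \<and>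
      (\<forall>k j. j < length (B \<omega> k) \<longrightarrow> a (n k + j) = B \<omega> k ! j)" for \<omega>
    using infinite_concatenation[of "B \<omega>" "\<beta> 0" ?R, OF ne hd path] unfolding len_B n_def by metis
  then obtain \<alpha> where \<alpha>: "\<And>\<omega> j. ?R (\<alpha> \<omega> j) (\<alpha> \<omega> (Suc j))"
    "\<And>\<omega> k j. j < length (B \<omega> k) \<Longrightarrow> \<alpha> \<omega> (n k + j) = B \<omega> k ! j"
    by metis
  have mono: "strict_mono n"
    by (simp add: strict_mono_Suc_iff n_def)
  show thesis
  proof (rule that[OF mono])
    show "\<alpha> \<omega> \<in> subshift A" for \<omega>
      using \<alpha>(1) by (simp add: subshift_def)
    show "\<alpha> \<omega> (n k + j) = \<beta> j" if "j \<le> m k" for \<omega> k j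
      using \<alpha>(2)[of j \<omega> k] that by (simp add: len_B B_def nth_append del: upt_Suc)
    show "\<exists>\<^sub>\<infinity>j. \<alpha> \<omega> j \<noteq> \<alpha> \<omega>' j" if ne: "\<omega> \<noteq> \<omega>'" for \<omega> \<omega>'
    proof -
      obtain x where x: "(x \<in> \<omega>) \<noteq> (x \<in> \<omega>')"
        using ne by blast
      have "\<exists>j\<ge>N. \<alpha> \<omega> j \<noteq> \<alpha> \<omega>' j" for N
      proof -
        \<comment> \<open>The first component makes block \<open>k\<close> test membership of
          \<open>x\<close>; the second forces \<open>k\<close> \<ge> \<open>N\<close>. Below,
          \<open>j\<close> is the place in that block where the two connecting words differ.\<close>
        define k where "k = prod_encode (x, N)"
        define j where "j = n k + (Suc (m k) + p)"
        have "N \<le> k"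
          by (simp add: k_def le_prod_encode_2)
        also have "k \<le> n k"
          using mono by (rule strict_mono_imp_increasing)
        finally have "N \<le> j"
          by (simp add: j_def)
        moreover have "\<alpha> w j = D (x \<in> w) ! p" for w
          using \<alpha>(2)[of "Suc (m k) + p" w k] p(1) len_D[of "x \<in> w"]
          by (simp add: len_B j_def B_def nth_append k_def del: upt_Suc)
        then have "\<alpha> \<omega> j \<noteq> \<alpha> \<omega>' j"
          using x p(2) by (cases "x \<in> \<omega>"; cases "x \<in> \<omega>'") auto
        ultimately show ?thesis
          by blast
      qed
      then show ?thesis
        by (simp add: INFM_nat_le)
    qed
  qed
qed

subsection \<open>Points with a prescribed itinerary\<close>

text \<open>The two claims need a joint induction: closedness of the next set uses continuity of the
  iterate on the present one. The next iterate is continuous there because the points have been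
  mapped into the union of the \<open>V i\<close>, the only place where \<open>f\<close> is known to
  be continuous.\<close>

lemma compact_itinerary_set:
  fixes f :: "nat \<Rightarrow> 'a::metric_space \<Rightarrow> 'a"
  assumes "\<And>i. compact (V i)" "\<And>n. continuous_on (\<Union>i. V i) (f n)"
    and "\<And>i n. closed (W i n)" "\<And>i n. W i n \<subseteq> V i"
  shows "compact (itinerary_set f W \<alpha> m n) \<and>
    continuous_on (itinerary_set f W \<alpha> m n) (nds_iter f n (Suc m))"
proof (induction m)
  case 0
  have *: "itinerary_set f W \<alpha> 0 n = W (\<alpha> 0) n"
    by (simp add: itinerary_set_def)
  have "compact (V (\<alpha> 0) \<inter> W (\<alpha> 0) n)"
    using assms by (intro compact_Int_closed)
  then show ?case
    using assms(4)[of "\<alpha> 0" n] continuous_on_subset[OF assms(2)[of n], of "W (\<alpha> 0) n"]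
    by (auto simp: * Int_absorb1)
next
  case (Suc m)
  let ?I = "itinerary_set f W \<alpha>"
  have *: "?I (Suc m) n = ?I m n \<inter> nds_iter f n (Suc m) -` W (\<alpha> (Suc m)) (n + Suc m)"
    by (auto simp: in_itinerary_set_iff le_Suc_eq)
  have "closed (?I (Suc m) n)"
    unfolding * using Suc assms(3) by (blast intro: continuous_closed_preimage compact_imp_closed)
  then have "compact (?I m n \<inter> ?I (Suc m) n)"
    using Suc by (intro compact_Int_closed) auto
  moreover have "?I m n \<inter> ?I (Suc m) n = ?I (Suc m) n"
    unfolding * by blast
  moreover have "continuous_on (?I (Suc m) n) (f (n + Suc m) \<circ> nds_iter f n (Suc m))"
  proof (rule continuous_on_compose)
    show "continuous_on (?I (Suc m) n) (nds_iter f n (Suc m))"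
      using Suc by (auto simp: * intro: continuous_on_subset)
    have "nds_iter f n (Suc m) ` ?I (Suc m) n \<subseteq> (\<Union>i. V i)"
      using assms(4) unfolding * by blast
    then show "continuous_on (nds_iter f n (Suc m) ` ?I (Suc m) n) (f (n + Suc m))"
      using assms(2) continuous_on_subset by blast
  qed
  ultimately show ?case
    by simp
qed

lemma itinerary_realized:
  fixes f :: "nat \<Rightarrow> 'a::metric_space \<Rightarrow> 'a"
  assumes "\<And>i. compact (V i)" "\<And>n. continuous_on (\<Union>i. V i) (f n)"
    and "\<And>i n. closed (W i n)" "\<And>i n. W i n \<subseteq> V i"
    and ne: "\<And>m. itinerary_set f W \<alpha> m n \<noteq> {}"
  obtains x where "\<And>k. nds_iter f n k x \<in> W (\<alpha> k) (n + k)"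
proof -
  let ?I = "\<lambda>m. itinerary_set f W \<alpha> m n"
  have cpt: "compact (?I m)" for m
    using compact_itinerary_set[of V f W, OF assms(1-4)] by blast
  \<comment> \<open>Finite intersection property inside the compact set \<open>?I 0\<close>. The
    sets decrease in \<open>m\<close>, so a point of the one with the largest index lies in all the
    others.\<close>
  have "?I 0 \<inter> (\<Inter>m\<in>UNIV. ?I m) \<noteq> {}"
  proof (rule compact_imp_fip_image[OF cpt])
    show "closed (?I m)" for m
      using cpt by (rule compact_imp_closed)
    fix F :: "nat set"
    assume "finite F"
    obtain x where x: "x \<in> ?I (Max (insert 0 F))"
      using ne by blast
    have "x \<in> ?I l" if "l \<in> insert 0 F" for l
    proof -
      have "l \<le> Max (insert 0 F)"
        using \<open>finite F\<close> that by (intro Max_ge) auto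
      with x show ?thesis
        unfolding in_itinerary_set_iff using order_trans by blast
    qed
    then have "x \<in> ?I 0 \<inter> (\<Inter>m\<in>F. ?I m)"
      by blast
    then show "?I 0 \<inter> (\<Inter>m\<in>F. ?I m) \<noteq> {}"
      by blast
  qed
  then obtain x where "\<And>m. x \<in> ?I m"
    by blast
  then show thesis
    by (intro that[of x]) (auto simp: in_itinerary_set_iff)
qed

text \<open>On a product of two disjoint nonempty compact sets the distance attains a positive
  minimum, and there are only finitely many pairs of indices.\<close>

lemma disjoint_compact_family_separated:
  fixes V :: "'n::finite \<Rightarrow> 'a::metric_space set"
  assumes "disjoint_family V" "\<And>i. compact (V i)"
  obtains \<delta> where "\<delta> > 0" "\<And>i j x y. i \<noteq> j \<Longrightarrow> x \<in> V i \<Longrightarrow> y \<in> V j \<Longrightarrow> \<delta> \<le> dist x y"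
proof -
  have "\<exists>d>0. \<forall>x\<in>V i. \<forall>y\<in>V j. d \<le> dist x y" if "i \<noteq> j" for i j
  proof (cases "V i \<times> V j = {}")
    case False
    have "compact (V i \<times> V j)"
      using assms(2) by (intro compact_Times)
    moreover have "continuous_on (V i \<times> V j) (\<lambda>q. dist (fst q) (snd q))"
      by (intro continuous_intros)
    ultimately obtain p where p: "p \<in> V i \<times> V j"
      "\<forall>q\<in>V i \<times> V j. dist (fst p) (snd p) \<le> dist (fst q) (snd q)"
      using continuous_attains_inf False by blast
    then have "fst p \<noteq> snd p"
      using assms(1) that unfolding disjoint_family_on_def by (metis IntI UNIV_I empty_iff mem_Times_iff)
    with p(2) show ?thesis
      by (intro exI[of _ "dist (fst p) (snd p)"]) auto
  qed (auto intro: exI[of _ 1])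
  \<comment> \<open>Any positive value will do for \<open>i = j\<close>; it lets the minimum run
    over all pairs.\<close>
  then have "\<exists>d>0. i \<noteq> j \<longrightarrow> (\<forall>x\<in>V i. \<forall>y\<in>V j. d \<le> dist x y)" for i j
    using zero_less_one by blast
  then obtain d where d: "\<And>i j. d i j > 0"
    "\<And>i j x y. i \<noteq> j \<Longrightarrow> x \<in> V i \<Longrightarrow> y \<in> V j \<Longrightarrow> d i j \<le> dist x y"
    by metis
  define \<delta> where "\<delta> = Min (range (\<lambda>(i, j). d i j))"
  have pos: "\<delta> > 0"
    using d(1) by (auto simp: \<delta>_def)
  have le: "\<delta> \<le> d i j" for i j
    unfolding \<delta>_def by (rule Min_le) (auto intro: range_eqI[of _ _ "(i, j)"])
  show thesis
    by (rule that[OF pos]) (rule order_trans[OF le d(2)])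
qed

theorem theorem3p1:
  fixes f :: "nat \<Rightarrow> 'a::metric_space \<Rightarrow> 'a"
    and A :: "nat ^ 'n::finite ^ 'n"
    and V :: "'n \<Rightarrow> 'a set"
    and W :: "'n \<Rightarrow> nat \<Rightarrow> 'a set"
  assumes "CARD('n) \<ge> 2"
    and "transition_matrix A"
    and "irreducible_matrix A"
    and "\<exists>i\<^sub>0. (\<Sum>j\<in>UNIV. A $ i\<^sub>0 $ j) \<ge> 2"
    and "disjoint_family V"
    and "\<And>i. V i \<noteq> {}"
    and "\<And>i. compact (V i)"
    and "\<And>n. continuous_on (\<Union>i. V i) (f n)"
    and "\<And>i n. W i n \<noteq> {}"
    and "\<And>i n. closed (W i n)"
    and "\<And>i n. W i n \<subseteq> V i"
    and "\<And>\<alpha> m n. \<alpha> \<in> subshift A \<Longrightarrow> itinerary_set f W \<alpha> m n \<noteq> {}"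
    and "\<exists>\<beta>\<in>subshift A. \<exists>m :: nat \<Rightarrow> nat. \<exists>s\<^sub>0.
           strict_mono m \<and> (\<forall>k. m k > 0) \<and> (\<forall>k. \<beta> (m k) = s\<^sub>0) \<and>
           (\<forall>n :: nat \<Rightarrow> nat. strict_mono n \<longrightarrow>
              (\<lambda>k. diameter (itinerary_set f W \<beta> (m k) (n k))) \<longlonglongrightarrow> 0)"
  shows "strong_li_yorke_chaotic f"
proof -
  obtain \<beta> m s where \<beta>: "\<beta> \<in> subshift A" "\<And>k. \<beta> (m k) = s"
    and diam: "\<And>n :: nat \<Rightarrow> nat. strict_mono n \<Longrightarrow>
      (\<lambda>k. diameter (itinerary_set f W \<beta> (m k) (n k))) \<longlonglongrightarrow> 0"
    using assms(13) by blast
  obtain \<alpha> :: "nat set \<Rightarrow> nat \<Rightarrow> 'n" and n where n: "strict_mono n"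
    and \<alpha>: "\<And>\<omega>. \<alpha> \<omega> \<in> subshift A"
    and agree: "\<And>\<omega> k j. j \<le> m k \<Longrightarrow> \<alpha> \<omega> (n k + j) = \<beta> j"
    and differ: "\<And>\<omega> \<omega>'. \<omega> \<noteq> \<omega>' \<Longrightarrow> \<exists>\<^sub>\<infinity>j. \<alpha> \<omega> j \<noteq> \<alpha> \<omega>' j"
    by (rule uncountable_itineraries[of A \<beta> m s, OF assms(2-4) \<beta>]) (rule that)
  obtain \<delta> where \<delta>: "\<delta> > 0"
    "\<And>i j x y. i \<noteq> j \<Longrightarrow> x \<in> V i \<Longrightarrow> y \<in> V j \<Longrightarrow> \<delta> \<le> dist x y"
    by (rule disjoint_compact_family_separated[OF assms(5,7)]) (rule that)
  have "\<exists>x. \<forall>k. nds_iter f 0 k x \<in> W (\<alpha> \<omega> k) k" for \<omega>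
    by (rule itinerary_realized[of V f W "\<alpha> \<omega>" 0, OF assms(7,8,10,11) assms(12)[OF \<alpha>]])
      (use add_0 in auto)
  then obtain X where X: "\<And>\<omega> k. nds_iter f 0 k (X \<omega>) \<in> W (\<alpha> \<omega> k) k"
    by metis
  then have XV: "nds_iter f 0 k (X \<omega>) \<in> V (\<alpha> \<omega> k)" for \<omega> k
    using assms(11) by blast
  let ?d = "\<lambda>\<omega> \<omega>' k. dist (nds_iter f 0 k (X \<omega>)) (nds_iter f 0 k (X \<omega>'))"
  have far: "\<exists>\<^sub>\<infinity>k. \<delta> \<le> ?d \<omega> \<omega>' k" if "\<omega> \<noteq> \<omega>'" for \<omega> \<omega>'
    using differ[OF that] by (rule INFM_mono) (use \<delta>(2) XV in blast)
  have close: "(\<lambda>k. ?d \<omega> \<omega>' (n k)) \<longlonglongrightarrow> 0" for \<omega> \<omega>'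
  proof (rule tendsto_sandwich[OF _ _ tendsto_const diam[OF n]])
    \<comment> \<open>From time \<open>n k\<close> on, the itinerary of every \<open>X\<close>
      \<omega> follows \<beta> for the indices 0 to \<open>m k\<close>, so both points lie in the
      set whose diameter tends to 0.\<close>
    have mem: "nds_iter f 0 (n k) (X \<omega>) \<in> itinerary_set f W \<beta> (m k) (n k)" for \<omega> k
      unfolding in_itinerary_set_iff nds_iter_add using X agree by metis
    show "\<forall>\<^sub>F k in sequentially. ?d \<omega> \<omega>' (n k) \<le> diameter (itinerary_set f W \<beta> (m k) (n k))"
    proof (intro always_eventually allI diameter_bounded_bound mem)
      \<comment> \<open>\<open>diameter\<close> bounds distances only on bounded sets.\<close>
      show "bounded (itinerary_set f W \<beta> (m k) (n k))" for k
        using compact_itinerary_set[of V f W, OF assms(7,8,10,11)] compact_imp_bounded by blast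
    qed
  qed simp
  have "inj X"
  proof (rule injI, rule ccontr)
    fix \<omega> \<omega>'
    assume "X \<omega> = X \<omega>'" "\<omega> \<noteq> \<omega>'"
    then show False
      using INFM_EX[OF far[of \<omega> \<omega>']] \<delta>(1) by simp
  qed
  then have "uncountable (range X)"
    using uncountable_UNIV_nat_set countable_image_inj_on by blast
  \<comment> \<open>Distances at least \<delta> infinitely often give only an upper limit \<ge>
    \<delta>, while a strict inequality is required; hence \<delta> / 2.\<close>
  moreover have "li_yorke_scrambled f (\<delta> / 2) (range X)"
    unfolding li_yorke_scrambled_def
  proof safe
    fix \<omega> \<omega>'
    assume "X \<omega> \<noteq> X \<omega>'"
    then have "\<omega> \<noteq> \<omega>'"
      by blast
    \<comment> \<open>Passing to the subsequence \<open>n\<close> can only raise the lower limit,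
      and there the distances tend to 0.\<close>
    have "liminf (\<lambda>k. ereal (?d \<omega> \<omega>' k)) \<le> liminf ((\<lambda>k. ereal (?d \<omega> \<omega>' k)) \<circ> n)"
      using n by (rule liminf_subseq_mono)
    also have "\<dots> = 0"
      using close[of \<omega> \<omega>'] by (intro lim_imp_Liminf) (simp_all add: o_def zero_ereal_def)
    finally show "liminf (\<lambda>k. ereal (?d \<omega> \<omega>' k)) = 0"
      by (intro antisym Liminf_bounded) auto
    show "ereal (\<delta> / 2) < limsup (\<lambda>k. ereal (?d \<omega> \<omega>' k))"
    proof (rule ccontr)
      assume "\<not> ?thesis"
      then have "limsup (\<lambda>k. ereal (?d \<omega> \<omega>' k)) \<le> ereal (\<delta> / 2)"
        by simp
      also have "ereal (\<delta> / 2) < ereal \<delta>"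
        using \<delta>(1) by simp
      finally have "limsup (\<lambda>k. ereal (?d \<omega> \<omega>' k)) < ereal \<delta>" .
      then have "\<forall>\<^sub>F k in sequentially. ?d \<omega> \<omega>' k < \<delta>"
        using Limsup_lessD by fastforce
      with far[OF \<open>\<omega> \<noteq> \<omega>'\<close>] show False
        by (simp add: frequently_def not_le cofinite_eq_sequentially)
    qed
  qed
  moreover have "bounded (range (\<lambda>k. nds_iter f 0 k (X \<omega>)))" for \<omega>
  proof (rule bounded_subset)
    show "bounded (\<Union>i. V i)"
      using assms(7) by (intro compact_imp_bounded compact_UN) auto
    show "range (\<lambda>k. nds_iter f 0 k (X \<omega>)) \<subseteq> (\<Union>i. V i)"
      using XV by blast
  qed
  ultimately show ?thesis
    unfolding strong_li_yorke_chaotic_def using \<delta>(1)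
    by (intro exI[of _ "\<delta> / 2"] conjI exI[of _ "range X"]) auto
qed

end
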